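(* Let $d\ge 1$ and let $G$ be a finite $d$-regular graph with at least $2d^3+2d-2d^2$ vertices. Then $b(G)=d+1$.
   Context: A $b$-coloring of a graph $G$ is a proper vertex coloring such that every color class contains a vertex (called dominant) adjacent to at least one vertex of each of the other color classes. The $b$-chromatic number $b(G)$ is the largest integer $k$ such that $G$ admits a $b$-coloring with $k$ colors. *)

theory Defs
  imports "Graph_Theory.Digraph"
begin

text \<open>
  A finite simple graph is an element of the locale \<^locale>\<open>graph\<close>: a finite, loop-free,
  symmetric digraph without parallel arcs. An undirected edge is a pair of opposite arcs, so
  the degree of a vertex is its out-degree.
\<close>

definition regular_graph :: "('a, 'b) pre_digraph \<Rightarrow> nat \<Rightarrow> bool" where
  "regular_graph G d \<longleftrightarrow> (\<forall>v\<in>verts G. out_degree G v = d)"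

definition proper_coloring :: "('a, 'b) pre_digraph \<Rightarrow> ('a \<Rightarrow> nat) \<Rightarrow> bool" where
  "proper_coloring G c \<longleftrightarrow>
     (\<forall>u\<in>verts G. \<forall>v\<in>verts G. u \<rightarrow>\<^bsub>G\<^esub> v \<longrightarrow> c u \<noteq> c v)"

text \<open>
  Only the colors actually used count, so all color classes are nonempty.
\<close>

definition colors :: "('a, 'b) pre_digraph \<Rightarrow> ('a \<Rightarrow> nat) \<Rightarrow> nat set" where
  "colors G c = c ` verts G"

definition color_class :: "('a, 'b) pre_digraph \<Rightarrow> ('a \<Rightarrow> nat) \<Rightarrow> nat \<Rightarrow> 'a set" where
  "color_class G c i = {v \<in> verts G. c v = i}"

definition dominant :: "('a, 'b) pre_digraph \<Rightarrow> ('a \<Rightarrow> nat) \<Rightarrow> 'a \<Rightarrow> bool" where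
  "dominant G c v \<longleftrightarrow>
     (\<forall>j\<in>colors G c. j \<noteq> c v \<longrightarrow> (\<exists>u\<in>color_class G c j. v \<rightarrow>\<^bsub>G\<^esub> u))"

definition b_coloring :: "('a, 'b) pre_digraph \<Rightarrow> ('a \<Rightarrow> nat) \<Rightarrow> bool" where
  "b_coloring G c \<longleftrightarrow>
     proper_coloring G c \<and>
     (\<forall>i\<in>colors G c. \<exists>v\<in>color_class G c i. dominant G c v)"

text \<open>
  For a finite graph, the set below is finite, being bounded by the number of vertices, and
  nonempty, since a proper coloring with the fewest possible colors is a b-coloring.
\<close>

definition b_chromatic_number :: "('a, 'b) pre_digraph \<Rightarrow> nat" where
  "b_chromatic_number G = Max {k. \<exists>c. b_coloring G c \<and> card (colors G c) = k}"

end

theory Submission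
  imports Defs
begin

text \<open>
  It suffices to find vertices $v_0, \dots, v_d$ with disjoint closed neighbourhoods, together
  with a proper coloring of these neighbourhoods with $d + 1$ colors in which $v_i$ has color $i$
  and sees all the other colors; the rest is colored greedily. The stars are colored one after
  the other. The next center $x$ lies outside the balls of radius 2 around the previous $k$
  centers, and these balls cover at most $k(d^2+1)$ vertices. The colors for $N(x)$ come from a
  perfect matching of $N(x)$ with the remaining colors that avoids the conflicts caused by paths
  $x, w, y$ with $y$ colored. It exists if there are fewer than $d$ such paths, and also if there
  are exactly $d$ of them but no color is excluded at every vertex of $N(x)$. Since each previous
  center starts at most $d(d-1)^2$ paths of length 3 leading out of the balls, averaging gives an
  $x$ with fewer than $d$ conflicts, except possibly in the last step, when the bound on the
  number of vertices is attained and all balls of radius 2 are disjoint. In that case an $x$ with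
  at most $d$ conflicts is made the first center instead of the last: stars around the other
  centers are then not adjacent to each other, and in conflict with the star of $x$ only, where
  each color occurs once and so cannot be excluded everywhere.
\<close>

section \<open>Bijections avoiding few forbidden pairs\<close>

text \<open>Local repair of an arbitrary bijection: exchanging the values of a bad point and another
  point shrinks the set of bad points if both new pairs avoid \<open>F\<close>. If no exchange is
  possible, the bound on \<open>card F\<close> fixes the shape of \<open>F\<close>, and
  \<open>row\<close> and \<open>col\<close> supply a cyclic exchange of three values.\<close>

lemma bij_betw_avoiding:
  fixes F :: "('a \<times> 'c) set"
  assumes fin: "finite W" "finite C" and card: "card W = card C"
    and F: "finite F" "card F \<le> card W"
    and row: "\<And>w. w \<in> W \<Longrightarrow> \<exists>c\<in>C. (w, c) \<notin> F"
    and col: "\<And>c. c \<in> C \<Longrightarrow> \<exists>w\<in>W. (w, c) \<notin> F"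
  shows "\<exists>h. bij_betw h W C \<and> (\<forall>w\<in>W. (w, h w) \<notin> F)"
proof -
  let ?bad = "\<lambda>h. {w \<in> W. (w, h w) \<in> F}"
  have "\<exists>h. bij_betw h W C \<and> ?bad h = {}" if "bij_betw h0 W C" for h0
    using that
  proof (induction "card (?bad h0)" arbitrary: h0 rule: less_induct)
    case less
    note f = less.prems
    show ?case
    proof (cases "?bad h0 = {}")
      case True
      then show ?thesis using f by blast
    next
      case False
      then obtain w where w: "w \<in> W" "(w, h0 w) \<in> F" by blast
      have inj: "inj_on h0 W" and img: "h0 ` W = C"
        using f by (auto simp: bij_betw_def)
      show ?thesis
      proof (cases "\<exists>v\<in>W - {w}. (w, h0 v) \<notin> F \<and> (v, h0 w) \<notin> F")
        case True
        then obtain v where v: "v \<in> W" "v \<noteq> w" "(w, h0 v) \<notin> F" "(v, h0 w) \<notin> F" by blast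
        let ?g = "h0(w := h0 v, v := h0 w)"
        have g: "bij_betw ?g W C"
          unfolding bij_betw_def
        proof
          show inj': "inj_on ?g W" using inj v w by (auto simp: inj_on_def)
          have "?g ` W \<subseteq> C" using v(1) w(1) img by auto
          then show "?g ` W = C"
            using fin(2) card card_image[OF inj'] by (intro card_subset_eq) auto
        qed
        have "?bad ?g \<subset> ?bad h0" using v w by auto
        then have "card (?bad ?g) < card (?bad h0)"
          using fin(1) by (intro psubset_card_mono) auto
        then show ?thesis using less.hyps[OF _ g] by blast
      next
        case False
        \<comment> \<open>Every swap with \<open>w\<close> is blocked by its own element of \<open>F\<close>; as \<open>F\<close> is small, all its
          elements lie in row \<open>w\<close> or column \<open>h0 w\<close>, and a 3-cycle removes every conflict.\<close>
        define \<phi> where "\<phi> v = (if (w, h0 v) \<in> F then (w, h0 v) else (v, h0 w))" for v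
        have \<phi>F: "\<phi> ` (W - {w}) \<subseteq> F - {(w, h0 w)}"
          using False inj w(1) by (auto simp: \<phi>_def inj_on_def split: if_splits)
        have "inj_on \<phi> (W - {w})"
          using inj w(1) by (auto simp: \<phi>_def inj_on_def split: if_splits)
        then have "card (\<phi> ` (W - {w})) = card W - 1"
          using w(1) fin(1) by (simp add: card_image)
        moreover have "card (F - {(w, h0 w)}) \<le> card W - 1"
          using w(2) F by simp
        ultimately have eq: "\<phi> ` (W - {w}) = F - {(w, h0 w)}"
          using \<phi>F F(1) by (metis card_seteq finite_Diff)
        have cross: "a = w \<or> c = h0 w" if "(a, c) \<in> F" for a c
        proof (rule ccontr)
          assume "\<not> (a = w \<or> c = h0 w)"
          then have "(a, c) \<in> \<phi> ` (W - {w})" using that eq by auto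
          then show False using \<open>\<not> (a = w \<or> c = h0 w)\<close> by (auto simp: \<phi>_def split: if_splits)
        qed
        obtain v1 where v1: "v1 \<in> W" "(w, h0 v1) \<notin> F"
          using row[OF w(1)] img by blast
        obtain v2 where v2: "v2 \<in> W" "(v2, h0 w) \<notin> F"
          using col[of "h0 w"] img w(1) by blast
        \<comment> \<open>If \<open>v1 = v2\<close>, the swap of \<open>w\<close> with this point
          would be unblocked.\<close>
        have ne: "v1 \<noteq> w" "v2 \<noteq> w" "v1 \<noteq> v2" using v1 v2 w False by auto
        let ?g = "h0(w := h0 v1, v1 := h0 v2, v2 := h0 w)"
        have "bij_betw ?g W C"
          unfolding bij_betw_def
        proof
          show inj': "inj_on ?g W" using inj v1(1) v2(1) w(1) ne by (auto simp: inj_on_def)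
          have "?g ` W \<subseteq> C" using v1(1) v2(1) w(1) img by auto
          then show "?g ` W = C"
            using fin(2) card card_image[OF inj'] by (intro card_subset_eq) auto
        qed
        \<comment> \<open>The new pairs of \<open>w\<close> and \<open>v2\<close> avoid
          \<open>F\<close> by choice. Every other point, \<open>v1\<close> included, has its pair
          outside row \<open>w\<close> and column \<open>h0 w\<close>, hence outside
          \<open>F\<close> by \<open>cross\<close>.\<close>
        moreover have "?bad ?g = {}"
        proof -
          have "(x, ?g x) \<notin> F" if "x \<in> W" for x
          proof
            assume a: "(x, ?g x) \<in> F"
            then have "x = w \<or> ?g x = h0 w" by (rule cross)
            then have "x = w \<or> x = v2"
              using that inj w(1) v1(1) v2(1) ne by (auto simp: inj_on_def split: if_splits)
            then show False using a v1 v2 ne by auto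
          qed
          then show ?thesis by blast
        qed
        ultimately show ?thesis by blast
      qed
    qed
  qed
  moreover obtain h0 where "bij_betw h0 W C"
    using finite_same_card_bij[OF fin card] by blast
  ultimately show ?thesis by blast
qed

section \<open>Colored stars in a regular graph\<close>

text \<open>The graph is encoded by its neighbourhood function. \<open>N_subset\<close> and
  \<open>N_sym\<close> together force \<open>N v = {}\<close> for \<open>v\<close> outside
  \<open>V\<close>.\<close>

locale regular_nbhd =
  fixes V :: "'a set" and N :: "'a \<Rightarrow> 'a set" and d :: nat
  assumes finite_V: "finite V"
    and N_subset: "N v \<subseteq> V"
    and N_sym: "u \<in> N v \<Longrightarrow> v \<in> N u"
    and N_irrefl: "v \<notin> N v"
    and card_N: "v \<in> V \<Longrightarrow> card (N v) = d"
begin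

definition star :: "'a \<Rightarrow> 'a set" where
  "star x = insert x (N x)"

definition ball2 :: "'a \<Rightarrow> 'a set" where
  "ball2 x = star x \<union> (\<Union>y\<in>N x. N y)"

definition stars :: "nat \<Rightarrow> (nat \<Rightarrow> 'a) \<Rightarrow> 'a set" where
  "stars k vs = (\<Union>i<k. star (vs i))"

text \<open>These are the conflicts of \<open>x\<close>: a path x, w, y with \<open>y\<close> in the
  colored set \<open>S\<close> forbids the color of \<open>y\<close> at \<open>w\<close>.\<close>

definition cross :: "'a set \<Rightarrow> 'a \<Rightarrow> ('a \<times> 'a) set" where
  "cross S x = (SIGMA w:N x. N w \<inter> S)"

text \<open>A partial coloring in which the first \<open>k\<close> centers already see all colors
  other than their own, so any proper extension keeps them dominant. Disjointness of the stars means
  that centers are at distance at least 3.\<close>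

definition valid :: "nat \<Rightarrow> (nat \<Rightarrow> 'a) \<Rightarrow> ('a \<Rightarrow> nat) \<Rightarrow> bool" where
  "valid k vs f \<longleftrightarrow>
     (\<forall>i<k. vs i \<in> V \<and> f (vs i) = i \<and> bij_betw f (N (vs i)) ({..d} - {i})) \<and>
     (\<forall>i<k. \<forall>j<k. i \<noteq> j \<longrightarrow> star (vs i) \<inter> star (vs j) = {}) \<and>
     (\<forall>u\<in>stars k vs. \<forall>w\<in>stars k vs. w \<in> N u \<longrightarrow> f u \<noteq> f w)"

lemma finite_N: "finite (N v)"
  using N_subset finite_V finite_subset by blast

lemma finite_cross: "finite (cross S x)"
  by (simp add: cross_def finite_N)

lemma stars_Suc: "stars (Suc k) vs = star (vs k) \<union> stars k vs"
  by (auto simp: stars_def less_Suc_eq)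

lemma stars_cong: "(\<And>i. i < k \<Longrightarrow> vs i = vs' i) \<Longrightarrow> stars k vs = stars k vs'"
  by (auto simp: stars_def)

lemma notin_ball2_iff: "x \<notin> ball2 y \<longleftrightarrow> star x \<inter> star y = {}"
  unfolding ball2_def star_def using N_sym by blast

text \<open>Each of the d neighbours of \<open>x\<close> adds at most d - 1 vertices besides
  \<open>x\<close>, and 1 + d + d(d - 1) = d^2 + 1.\<close>

lemma card_ball2_le:
  assumes "x \<in> V"
  shows "card (ball2 x) \<le> d ^ 2 + 1"
proof -
  let ?U = "\<Union>y\<in>N x. N y - {x}"
  have eq: "ball2 x = insert x (N x \<union> ?U)" by (auto simp: ball2_def star_def)
  have c: "card (N y - {x}) = d - 1" if "y \<in> N x" for y
    using that N_sym[OF that] N_subset finite_N card_N by (subst card_Diff_singleton) auto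
  have "card ?U \<le> (\<Sum>y\<in>N x. card (N y - {x}))"
    by (rule card_UN_le[OF finite_N])
  also have "\<dots> = d * (d - 1)" using c card_N[OF assms] by simp
  finally have U: "card ?U \<le> d * (d - 1)" .
  have "card (ball2 x) \<le> 1 + (card (N x) + card ?U)"
    unfolding eq using card_Un_le[of "N x" ?U] card_insert_if[of "N x \<union> ?U" x]
    by (simp add: finite_N)
  also have "\<dots> \<le> 1 + (d + d * (d - 1))" using U card_N[OF assms] by simp
  also have "\<dots> = d ^ 2 + 1" by (cases d) (simp_all add: power2_eq_square)
  finally show ?thesis .
qed

text \<open>The coloring of \<open>N x\<close> is a bijection onto the colors other than
  \<open>k\<close>, obtained from \<open>bij_betw_avoiding\<close>. The hypothesis
  \<open>dis\<close> keeps the new star off the old ones, \<open>few\<close> bounds the number of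
  forbidden pairs, and \<open>col\<close> is the column condition.\<close>

lemma extend_star:
  assumes val: "valid k vs f" and k: "k \<le> d" and x: "x \<in> V"
    and dis: "\<And>i. i < k \<Longrightarrow> x \<notin> ball2 (vs i)"
    and few: "card (cross (stars k vs) x) \<le> d"
    and col: "\<And>c. c \<le> d \<Longrightarrow> c \<noteq> k \<Longrightarrow> \<exists>w\<in>N x. \<forall>y\<in>N w \<inter> stars k vs. f y \<noteq> c"
  shows "\<exists>g. valid (Suc k) (vs(k := x)) g"
proof -
  let ?S = "stars k vs" and ?C = "{..d} - {k}"
  define F where "F = (\<lambda>(w, y). (w, f y)) ` cross ?S x"
  have S_dis: "star x \<inter> ?S = {}"
    using dis unfolding notin_ball2_iff stars_def by blast
  have F_iff: "(w, c) \<in> F \<longleftrightarrow> w \<in> N x \<and> (\<exists>y\<in>N w \<inter> ?S. f y = c)" for w c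
    by (auto simp: F_def cross_def image_iff)
  have cC: "card ?C = d" using k by simp
  have "\<exists>h. bij_betw h (N x) ?C \<and> (\<forall>w\<in>N x. (w, h w) \<notin> F)"
  proof (rule bij_betw_avoiding)
    show "finite (N x)" by (rule finite_N)
    show "card (N x) = card ?C" using card_N[OF x] cC by simp
    show "finite F" using finite_cross by (simp add: F_def)
    have "card F \<le> card (cross ?S x)" unfolding F_def using finite_cross by (rule card_image_le)
    then show "card F \<le> card (N x)" using few card_N[OF x] by simp
    \<comment> \<open>The row condition is automatic: \<open>x\<close> is a neighbour of
      \<open>w\<close> outside the old stars, so at most d - 1 neighbours of \<open>w\<close> are
      colored, too few to exclude all d colors.\<close>
    show "\<exists>c\<in>?C. (w, c) \<notin> F" if w: "w \<in> N x" for w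
    proof (rule ccontr)
      assume "\<not> ?thesis"
      then have F_all: "(w, c) \<in> F" if "c \<in> ?C" for c using that by blast
      have "?C \<subseteq> f ` (N w \<inter> ?S)"
      proof
        fix c assume "c \<in> ?C"
        then show "c \<in> f ` (N w \<inter> ?S)" using F_all[of c] unfolding F_iff by blast
      qed
      moreover have "N w \<inter> ?S \<subseteq> N w - {x}" using S_dis by (auto simp: star_def)
      ultimately have "?C \<subseteq> f ` (N w - {x})" by blast
      then have "d \<le> card (N w - {x})"
        using surj_card_le[of "N w - {x}" ?C f] finite_N cC by simp
      moreover have "card (N w - {x}) < card (N w)"
        using N_sym[OF w] finite_N by (intro psubset_card_mono) auto
      ultimately show False using card_N N_subset w by (metis not_le subsetD)
    qed
    show "\<exists>w\<in>N x. (w, c) \<notin> F" if "c \<in> ?C" for c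
      using col[of c] that unfolding F_iff by blast
  qed simp
  then obtain h where h: "bij_betw h (N x) ?C" and hF: "\<And>w. w \<in> N x \<Longrightarrow> (w, h w) \<notin> F"
    by blast
  define g where "g u = (if u = x then k else if u \<in> N x then h u else f u)" for u
  have g_S: "g u = f u" if "u \<in> ?S" for u
    using that S_dis by (auto simp: g_def star_def)
  have g_N: "g u = h u" if "u \<in> N x" for u
    using that N_irrefl by (auto simp: g_def)
  have g_x: "g x = k" by (simp add: g_def)
  let ?vs = "vs(k := x)"
  have st: "stars k ?vs = ?S" by (rule stars_cong) simp
  have h_in: "h u \<le> d \<and> h u \<noteq> k" if "u \<in> N x" for u
    using bij_betwE[OF h] that by auto
  have sub: "star (vs i) \<subseteq> ?S" if "i < k" for i using that by (auto simp: stars_def)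
  \<comment> \<open>An edge from an old star can reach the new star only in \<open>N x\<close>,
    where \<open>F\<close> excludes equal colors. Inside the new star all colors differ.\<close>
  have proper: "g u \<noteq> g w" if "u \<in> star x \<union> ?S" "w \<in> star x" "w \<in> N u" for u w
  proof (cases "u \<in> ?S")
    case True
    then have "w \<noteq> x" using that S_dis N_sym[of w u] by (auto simp: star_def)
    then have w: "w \<in> N x" using that by (auto simp: star_def)
    have "(w, f u) \<in> F" using F_iff w True N_sym[OF that(3)] by auto
    then show ?thesis using hF[OF w] g_S[OF True] g_N[OF w] by auto
  next
    case False
    then have "u \<in> star x" using that(1) by simp
    then consider "u = x" | "u \<in> N x" unfolding star_def by blast
    then show ?thesis
    proof cases
      case 1
      then show ?thesis using that(3) h_in[of w] g_N[of w] g_x by simp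
    next
      case 2
      show ?thesis
      proof (cases "w = x")
        case True
        then show ?thesis using 2 h_in[of u] g_N[of u] g_x by simp
      next
        case False
        then have "w \<in> N x" "u \<noteq> w" using that N_irrefl by (auto simp: star_def)
        then show ?thesis
          using 2 g_N bij_betw_imp_inj_on[OF h] by (simp add: inj_on_eq_iff)
      qed
    qed
  qed
  have "valid (Suc k) ?vs g"
    unfolding valid_def
  proof (intro conjI allI impI ballI)
    fix i assume i: "i < Suc k"
    show "?vs i \<in> V" using i x val by (auto simp: valid_def less_Suc_eq)
    show "g (?vs i) = i"
      using i g_x g_S sub val by (auto simp: valid_def less_Suc_eq star_def)
    show "bij_betw g (N (?vs i)) ({..d} - {i})"
    proof (cases "i = k")
      case True
      then show ?thesis using h g_N bij_betw_cong[of "N x" g h] by simp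
    next
      case False
      then have "i < k" using i by simp
      then have "bij_betw f (N (vs i)) ({..d} - {i})" using val by (simp add: valid_def)
      moreover have "g u = f u" if "u \<in> N (vs i)" for u
        using that g_S sub[OF \<open>i < k\<close>] by (auto simp: star_def)
      ultimately show ?thesis using False bij_betw_cong[of "N (vs i)" g f] by simp
    qed
    fix j assume j: "j < Suc k" and ij: "i \<noteq> j"
    have xd: "star x \<inter> star (vs l) = {}" if "l < k" for l
      using dis[OF that] unfolding notin_ball2_iff .
    have "star (vs i) \<inter> star (vs j) = {}" if "i < k" "j < k"
      using val that ij unfolding valid_def by blast
    then show "star (?vs i) \<inter> star (?vs j) = {}"
      using i j ij xd by (auto simp: less_Suc_eq Int_commute)
  next
    fix u w assume "u \<in> stars (Suc k) ?vs" "w \<in> stars (Suc k) ?vs" and a: "w \<in> N u"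
    then have uw: "u \<in> star x \<union> ?S" "w \<in> star x \<union> ?S" by (simp_all add: stars_Suc st)
    show "g u \<noteq> g w"
    proof (cases "u \<in> star x \<or> w \<in> star x")
      case True
      then show ?thesis using proper[of u w] proper[of w u] uw a N_sym[OF a] by auto
    next
      case False
      then show ?thesis using uw g_S val a by (auto simp: valid_def)
    qed
  qed
  then show ?thesis by blast
qed

text \<open>With fewer than d conflicts, some vertex of \<open>N x\<close> has none, so no color is
  excluded on all of \<open>N x\<close>.\<close>

lemma extend_star_strict:
  assumes val: "valid k vs f" and k: "k \<le> d" and x: "x \<in> V"
    and dis: "\<And>i. i < k \<Longrightarrow> x \<notin> ball2 (vs i)"
    and few: "card (cross (stars k vs) x) < d"
  shows "\<exists>g. valid (Suc k) (vs(k := x)) g"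
proof (rule extend_star[OF val k x dis])
  show "card (cross (stars k vs) x) \<le> d" using few by simp
  fix c assume "c \<le> d" "c \<noteq> k"
  show "\<exists>w\<in>N x. \<forall>y\<in>N w \<inter> stars k vs. f y \<noteq> c"
  proof (rule ccontr)
    assume "\<not> ?thesis"
    then have "N x \<subseteq> fst ` cross (stars k vs) x" by (force simp: cross_def)
    then have "card (N x) \<le> card (cross (stars k vs) x)"
      using finite_cross surj_card_le by blast
    then show False using few card_N[OF x] by simp
  qed
qed

section \<open>Counting conflicts and balls\<close>

text \<open>A conflict x, w, y with \<open>y\<close> in the star of \<open>vs i\<close> continues to
  this center. Read backwards it is a path of length 3 that leaves the center without backtracking:
  d choices for \<open>y\<close>, then d - 1 each for \<open>w\<close> and \<open>x\<close>.\<close>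

lemma sum_cross_le:
  assumes "valid k vs f"
  shows "(\<Sum>x\<in>V - (\<Union>i<k. ball2 (vs i)). card (cross (stars k vs) x)) \<le> k * (d * (d - 1) ^ 2)"
proof -
  let ?U = "\<Union>i<k. ball2 (vs i)"
  let ?A = "SIGMA x:V - ?U. cross (stars k vs) x"
  let ?B = "SIGMA i:{..<k}. SIGMA y:N (vs i). SIGMA w:N y - {vs i}. N w - {y}"
  have vsV: "vs i \<in> V" if "i < k" for i using assms that by (simp add: valid_def)
  have c: "card (N y - {z}) = d - 1" if "z \<in> N y" for y z
    using that N_sym[OF that] N_subset card_N finite_N by (subst card_Diff_singleton) auto
  have sub: "?A \<subseteq> (\<lambda>(i, y, w, x). (x, w, y)) ` ?B"
  proof
    fix p assume "p \<in> ?A"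
    then obtain x w y where p: "p = (x, w, y)" "x \<in> V" "x \<notin> ?U" "w \<in> N x" "y \<in> N w"
      "y \<in> stars k vs" by (auto simp: cross_def)
    then obtain i where i: "i < k" "y \<in> star (vs i)" by (auto simp: stars_def)
    \<comment> \<open>Each of \<open>y = vs i\<close>, \<open>w = vs i\<close> and
      \<open>x = y\<close> would give the two stars a common vertex.\<close>
    have xi: "star x \<inter> star (vs i) = {}" using p i notin_ball2_iff by blast
    have "y \<noteq> vs i" using xi p(4,5) N_sym by (auto simp: star_def)
    then have y: "y \<in> N (vs i)" using i by (auto simp: star_def)
    have "w \<noteq> vs i" using xi p(4) by (auto simp: star_def)
    moreover have "x \<noteq> y" using xi i by (auto simp: star_def)
    ultimately have "(i, y, w, x) \<in> ?B" using i y p N_sym by auto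
    then show "p \<in> (\<lambda>(i, y, w, x). (x, w, y)) ` ?B" using p(1) by force
  qed
  have finB: "finite ?B" by (intro finite_SigmaI) (auto simp: finite_N)
  have "card (SIGMA w:N y - {vs i}. N w - {y}) = (d - 1) ^ 2" if "y \<in> N (vs i)" for i y
  proof -
    have "card (SIGMA w:N y - {vs i}. N w - {y}) = (\<Sum>w\<in>N y - {vs i}. card (N w - {y}))"
      by (rule card_SigmaI) (auto simp: finite_N)
    also have "\<dots> = (\<Sum>w\<in>N y - {vs i}. d - 1)"
    proof (rule sum.cong)
      show "card (N w - {y}) = d - 1" if "w \<in> N y - {vs i}" for w
        using that by (intro c N_sym[of w y]) simp
    qed simp
    also have "\<dots> = (d - 1) ^ 2" using c[OF N_sym[OF that]] by (simp add: power2_eq_square)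
    finally show ?thesis .
  qed
  then have "card (SIGMA y:N (vs i). SIGMA w:N y - {vs i}. N w - {y}) = d * (d - 1) ^ 2"
    if "i < k" for i
    using card_N[OF vsV[OF that]] by (subst card_SigmaI) (auto simp: finite_N)
  then have cB: "card ?B = k * (d * (d - 1) ^ 2)"
    by (subst card_SigmaI) (auto simp: finite_N)
  have "(\<Sum>x\<in>V - ?U. card (cross (stars k vs) x)) = card ?A"
    using finite_V finite_cross by (subst card_SigmaI) auto
  also have "\<dots> \<le> card ?B" by (rule surj_card_le[OF finB sub])
  finally show ?thesis using cB by simp
qed

lemma card_ball2s_le:
  assumes "valid k vs f"
  shows "card (\<Union>i<k. ball2 (vs i)) \<le> k * (d ^ 2 + 1)"
proof -
  have "card (\<Union>i<k. ball2 (vs i)) \<le> (\<Sum>i<k. card (ball2 (vs i)))"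
    by (rule card_UN_le) simp
  also have "\<dots> \<le> (\<Sum>i<k. d ^ 2 + 1)"
    using assms by (intro sum_mono card_ball2_le) (auto simp: valid_def)
  finally show ?thesis by simp
qed

lemma finite_ball2: "finite (ball2 x)"
  by (simp add: ball2_def star_def finite_N)

text \<open>Equality case of \<open>card_ball2s_le\<close>: a shared vertex could be deleted from
  one ball without changing the union, so the union would be strictly smaller than the
  bound.\<close>

lemma ball2s_disjoint:
  assumes val: "valid k vs f" and card: "card (\<Union>i<k. ball2 (vs i)) \<ge> k * (d ^ 2 + 1)"
    and ij: "i < k" "j < k" "i \<noteq> j"
  shows "ball2 (vs i) \<inter> ball2 (vs j) = {}"
proof (rule ccontr)
  assume "\<not> ?thesis"
  then obtain z where z: "z \<in> ball2 (vs i)" "z \<in> ball2 (vs j)" by blast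
  let ?B = "\<lambda>l. if l = j then ball2 (vs l) - {z} else ball2 (vs l)"
  have "(\<Union>i<k. ball2 (vs i)) \<subseteq> (\<Union>l<k. ?B l)"
    using z ij by auto
  then have "card (\<Union>i<k. ball2 (vs i)) \<le> card (\<Union>l<k. ?B l)"
    by (intro card_mono) (auto simp: finite_ball2)
  also have "\<dots> \<le> (\<Sum>l<k. card (?B l))" by (rule card_UN_le) simp
  also have "\<dots> < (\<Sum>l<k. d ^ 2 + 1)"
  proof (rule sum_strict_mono_ex1)
    have b: "card (ball2 (vs l)) \<le> d ^ 2 + 1" if "l < k" for l
      using val that by (intro card_ball2_le) (auto simp: valid_def)
    have lt: "card (ball2 (vs j) - {z}) < card (ball2 (vs j))"
      using z finite_ball2 by (intro psubset_card_mono) auto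
    show "\<exists>l\<in>{..<k}. card (?B l) < d ^ 2 + 1"
      using lt b[OF ij(2)] ij(2) by (intro bexI[of _ j]) auto
    show "\<forall>l\<in>{..<k}. card (?B l) \<le> d ^ 2 + 1"
      using lt b by (auto intro: le_trans[OF less_imp_le])
  qed simp
  finally show False using card by simp
qed

section \<open>Greedy extension of a proper coloring\<close>

text \<open>A vertex has at most d neighbours, so one of the d + 1 colors is always free.\<close>

lemma extend_coloring:
  assumes "finite T" "S \<union> T \<subseteq> V" "f ` S \<subseteq> {..d}"
    and "\<forall>u\<in>S. \<forall>w\<in>S. w \<in> N u \<longrightarrow> f u \<noteq> f w"
  shows "\<exists>g. (\<forall>u\<in>S. g u = f u) \<and> g ` (S \<union> T) \<subseteq> {..d} \<and>
    (\<forall>u\<in>S \<union> T. \<forall>w\<in>S \<union> T. w \<in> N u \<longrightarrow> g u \<noteq> g w)"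
  using assms(1,2)
proof (induction T)
  case empty
  then show ?case using assms by (intro exI[of _ f]) auto
next
  case (insert t T)
  then obtain g where g: "\<forall>u\<in>S. g u = f u" "g ` (S \<union> T) \<subseteq> {..d}"
    "\<forall>u\<in>S \<union> T. \<forall>w\<in>S \<union> T. w \<in> N u \<longrightarrow> g u \<noteq> g w" by auto
  show ?case
  proof (cases "t \<in> S")
    case True
    then have "S \<union> insert t T = S \<union> T" by blast
    then show ?thesis using g by auto
  next
    case False
    \<comment> \<open>Values of \<open>g\<close> at neighbours still to be treated are avoided as
      well; the count of d covers them too.\<close>
    have "card (g ` N t) \<le> d"
      using card_N[of t] card_image_le[OF finite_N, of g t] insert.prems by auto
    then have "\<not> {..d} \<subseteq> g ` N t"
      using finite_N card_mono[of "g ` N t" "{..d}"] by auto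
    then obtain c where c: "c \<le> d" "c \<notin> g ` N t" by auto
    let ?g = "g(t := c)"
    have "?g u \<noteq> ?g w" if "u \<in> S \<union> insert t T" "w \<in> S \<union> insert t T" "w \<in> N u" for u w
      using that g(3) c(2) N_irrefl N_sym[OF that(3)] by (cases "u = t"; cases "w = t") auto
    moreover have "\<forall>u\<in>S. ?g u = f u" using g(1) False by auto
    moreover have "?g ` (S \<union> insert t T) \<subseteq> {..d}" using g(2) c(1) by auto
    ultimately show ?thesis by blast
  qed
qed

section \<open>Finding the centers by averaging\<close>

text \<open>Applied with \<open>m = d\<close> to find a vertex with fewer than d conflicts, where
  the leading factor d cancels, and with \<open>m = Suc d\<close> to find one with at most
  d.\<close>

lemma average_cross:
  assumes val: "valid k vs f"
    and all: "\<And>x. x \<in> V - (\<Union>i<k. ball2 (vs i)) \<Longrightarrow> m \<le> card (cross (stars k vs) x)"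
  shows "m * card (V - (\<Union>i<k. ball2 (vs i))) \<le> d * (k * (d - 1) ^ 2)"
proof -
  let ?X = "V - (\<Union>i<k. ball2 (vs i))"
  have "m * card ?X = (\<Sum>x\<in>?X. m)" by simp
  also have "\<dots> \<le> (\<Sum>x\<in>?X. card (cross (stars k vs) x))" by (rule sum_mono) (rule all)
  also have "\<dots> \<le> k * (d * (d - 1) ^ 2)" by (rule sum_cross_le[OF val])
  finally show ?thesis by (simp add: algebra_simps)
qed

lemma card_V_split:
  fixes k :: nat and vs :: "nat \<Rightarrow> 'a"
  shows "card V \<le> card (\<Union>i<k. ball2 (vs i)) + card (V - (\<Union>i<k. ball2 (vs i)))"
proof -
  have "card V \<le> card ((\<Union>i<k. ball2 (vs i)) \<union> (V - (\<Union>i<k. ball2 (vs i))))"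
    using finite_V by (intro card_mono) (auto simp: finite_ball2)
  then show ?thesis using card_Un_le le_trans by blast
qed

text \<open>If every vertex outside the balls had at least d conflicts, at most k(d - 1)^2 vertices
  would lie outside. With at most k(d^2 + 1) inside, this contradicts the size of \<open>V\<close>
  as long as k < d.\<close>

lemma exists_valid:
  assumes d: "d \<ge> 1" and big: "card V \<ge> d * (d ^ 2 + 1 + (d - 1) ^ 2)"
  shows "k \<le> d \<Longrightarrow> \<exists>vs f. valid k vs f"
proof (induction k)
  case 0
  show ?case by (auto simp: valid_def stars_def)
next
  case (Suc k)
  then obtain vs f where val: "valid k vs f" by auto
  let ?X = "V - (\<Union>i<k. ball2 (vs i))"
  have "\<exists>x\<in>?X. card (cross (stars k vs) x) < d"
  proof (rule ccontr)
    assume "\<not> ?thesis"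
    then have "d * card ?X \<le> d * (k * (d - 1) ^ 2)"
      by (intro average_cross[OF val]) (auto simp: not_less)
    then have "card ?X \<le> k * (d - 1) ^ 2" using d by simp
    then have "card V \<le> k * (d ^ 2 + 1) + k * (d - 1) ^ 2"
      using card_V_split[where k = k and vs = vs] card_ball2s_le[OF val] by linarith
    also have "\<dots> = k * (d ^ 2 + 1 + (d - 1) ^ 2)" by (simp add: algebra_simps)
    also have "\<dots> < d * (d ^ 2 + 1 + (d - 1) ^ 2)" using Suc.prems by (intro mult_strict_right_mono) auto
    finally show False using big by simp
  qed
  then obtain x where "x \<in> V" "\<And>i. i < k \<Longrightarrow> x \<notin> ball2 (vs i)" "card (cross (stars k vs) x) < d"
    by blast
  then show ?case using extend_star_strict[OF val] Suc.prems by (meson Suc_leD)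
qed

text \<open>The coloring is restarted with \<open>x\<close> as center 0 and \<open>vs k\<close> as
  center \<open>Suc k\<close>; from \<open>f\<close> only the position of the stars is kept. The
  stars of the \<open>vs j\<close> have no edges between them, so every conflict of
  \<open>vs k\<close> comes from an edge between \<open>N (vs k)\<close> and
  \<open>N x\<close>.\<close>

lemma valid_disjoint_balls:
  assumes d: "d \<ge> 1" and val: "valid d vs f"
    and disj: "\<And>i j. i < d \<Longrightarrow> j < d \<Longrightarrow> i \<noteq> j \<Longrightarrow> ball2 (vs i) \<inter> ball2 (vs j) = {}"
    and x: "x \<in> V" "\<And>i. i < d \<Longrightarrow> x \<notin> ball2 (vs i)"
    and few: "card (cross (stars d vs) x) \<le> d"
  shows "k \<le> d \<Longrightarrow> \<exists>g. valid (Suc k) (case_nat x vs) g"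
proof (induction k)
  case 0
  have "valid 0 (case_nat x vs) f" by (simp add: valid_def stars_def)
  then have "\<exists>g. valid (Suc 0) ((case_nat x vs)(0 := x)) g"
    using d x(1) by (intro extend_star_strict) (auto simp: cross_def stars_def)
  moreover have "(case_nat x vs)(0 := x) = case_nat x vs" by (auto split: nat.split)
  ultimately show ?case by simp
next
  case (Suc k)
  let ?vs = "case_nat x vs"
  let ?z = "vs k"
  let ?S = "stars (Suc k) ?vs"
  from Suc obtain g where g: "valid (Suc k) ?vs g" by auto
  have k: "k < d" using Suc.prems by simp
  have z: "?z \<in> V" using val k by (simp add: valid_def)
  have xz: "star x \<inter> star ?z = {}" using x(2)[OF k] notin_ball2_iff by blast
  \<comment> \<open>If \<open>y\<close> were in the star of an earlier \<open>vs j\<close>, it would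
    lie in two disjoint balls; if \<open>y = x\<close>, then \<open>w\<close> would lie in the stars
    of both \<open>x\<close> and \<open>vs k\<close>.\<close>
  have in_Nx: "y \<in> N x" if w: "w \<in> N ?z" and y: "y \<in> N w" "y \<in> ?S" for w y
  proof -
    obtain i where i: "i < Suc k" "y \<in> star (?vs i)" using y by (auto simp: stars_def)
    show ?thesis
    proof (cases i)
      case 0
      then show ?thesis using i w y xz N_sym by (auto simp: star_def)
    next
      case (Suc j)
      then have j: "j < k" "y \<in> star (vs j)" using i by auto
      then have "y \<in> ball2 (vs j)" "y \<in> ball2 ?z" using w y by (auto simp: ball2_def)
      then show ?thesis using disj[of j k] j k by auto
    qed
  qed
  have "\<exists>g. valid (Suc (Suc k)) (?vs(Suc k := ?z)) g"
  proof (rule extend_star[OF g Suc.prems z])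
    show "?z \<notin> ball2 (?vs i)" if "i < Suc k" for i
    proof (cases i)
      case 0
      then show ?thesis using xz notin_ball2_iff by (simp add: Int_commute)
    next
      case (Suc j)
      then show ?thesis using that val k unfolding notin_ball2_iff by (auto simp: valid_def)
    qed
    \<comment> \<open>Reversing the middle edge turns each conflict of \<open>vs k\<close> into a
      conflict of \<open>x\<close>, and these number at most d.\<close>
    have "cross ?S ?z \<subseteq> prod.swap ` cross (stars d vs) x"
    proof
      fix p assume "p \<in> cross ?S ?z"
      then obtain w y where p: "p = (w, y)" "w \<in> N ?z" "y \<in> N w" "y \<in> ?S"
        by (auto simp: cross_def)
      then have "y \<in> N x" "w \<in> N y" using in_Nx N_sym by auto
      moreover have "w \<in> stars d vs" using p k by (auto simp: stars_def star_def)
      ultimately have "(y, w) \<in> cross (stars d vs) x" by (simp add: cross_def)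
      then show "p \<in> prod.swap ` cross (stars d vs) x" using p(1) by force
    qed
    then have "card (cross ?S ?z) \<le> card (cross (stars d vs) x)"
      by (rule surj_card_le[OF finite_cross])
    then show "card (cross ?S ?z) \<le> d" using few by simp
    fix c assume c: "c \<le> d" "c \<noteq> Suc k"
    show "\<exists>w\<in>N ?z. \<forall>y\<in>N w \<inter> ?S. g y \<noteq> c"
    \<comment> \<open>Color \<open>c\<close> occurs at only one vertex \<open>y0\<close> of
      \<open>N x\<close>. If it were excluded everywhere, \<open>y0\<close> would be adjacent to all
      d vertices of \<open>N (vs k)\<close> and also to \<open>x\<close>, giving it degree above
      d.\<close>
    proof (rule ccontr)
      assume "\<not> ?thesis"
      then have ex: "\<exists>y\<in>N x. w \<in> N y \<and> g y = c" if "w \<in> N ?z" for w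
        using that in_Nx N_sym by blast
      have "N ?z \<noteq> {}" using card_N[OF z] d by auto
      then obtain y0 where y0: "y0 \<in> N x" "g y0 = c" using ex by blast
      have "inj_on g (N x)"
      proof -
        have "bij_betw g (N (?vs 0)) ({..d} - {0})"
          using g unfolding valid_def by blast
        then show ?thesis by (simp add: bij_betw_def)
      qed
      then have "w \<in> N y0" if "w \<in> N ?z" for w
        using ex[OF that] y0 by (metis inj_onD)
      then have "N ?z \<subset> N y0"
        using N_sym[OF y0(1)] xz by (auto simp: star_def)
      then have "card (N ?z) < card (N y0)" using finite_N psubset_card_mono by blast
      then show False using card_N z y0(1) N_subset by (metis less_irrefl subsetD)
    qed
  qed
  moreover have "?vs(Suc k := ?z) = ?vs" by (auto split: nat.split)
  ultimately show ?case by simp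
qed

text \<open>At k = d the averaging has no slack left. If it fails, at most d(d - 1)^2 vertices lie
  outside the balls, so the balls attain their maximal total size, are disjoint, and
  \<open>valid_disjoint_balls\<close> applies.\<close>

lemma exists_valid_full:
  assumes d: "d \<ge> 2" and big: "card V \<ge> d * (d ^ 2 + 1 + (d - 1) ^ 2)"
  shows "\<exists>vs f. valid (Suc d) vs f"
proof -
  have d1: "d \<ge> 1" using d by simp
  obtain vs f where val: "valid d vs f" using exists_valid[OF d1 big, of d] by auto
  let ?U = "\<Union>i<d. ball2 (vs i)"
  let ?X = "V - ?U"
  let ?Y = "d * (d - 1) ^ 2"
  have big': "card V \<ge> d * (d ^ 2 + 1) + ?Y" using big by (simp add: algebra_simps)
  show ?thesis
  proof (cases "\<exists>x\<in>?X. card (cross (stars d vs) x) < d")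
    case True
    then obtain x where "x \<in> V" "\<And>i. i < d \<Longrightarrow> x \<notin> ball2 (vs i)"
      "card (cross (stars d vs) x) < d" by blast
    then show ?thesis using extend_star_strict[OF val order_refl] by blast
  next
    case False
    then have "d * card ?X \<le> d * ?Y"
      by (intro average_cross[OF val]) (auto simp: not_less)
    then have "card ?X \<le> ?Y" using d1 by simp
    then have "d * (d ^ 2 + 1) \<le> card ?U"
      using card_V_split[where k = d and vs = vs] big' by linarith
    note disj = ball2s_disjoint[OF val this]
    have X: "?Y \<le> card ?X"
      using card_V_split[where k = d and vs = vs] big' card_ball2s_le[OF val] by linarith
    have "\<exists>x\<in>?X. card (cross (stars d vs) x) \<le> d"
    \<comment> \<open>Otherwise (d + 1) \<open>card ?X\<close> is at most d \<open>?Y\<close>, hence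
      at most d \<open>card ?X\<close>, so \<open>?X\<close> is empty. But \<open>?Y\<close> is
      positive for d at least 2.\<close>
    proof (rule ccontr)
      assume "\<not> ?thesis"
      then have "Suc d * card ?X \<le> d * ?Y"
        by (intro average_cross[OF val]) (auto simp: not_le Suc_le_eq)
      moreover have "d * ?Y \<le> d * card ?X" using X by (rule mult_le_mono2)
      moreover have "Suc d * card ?X = card ?X + d * card ?X" by simp
      ultimately have "card ?X = 0" by linarith
      then show False using X d by simp
    qed
    then obtain x where "x \<in> V" "\<And>i. i < d \<Longrightarrow> x \<notin> ball2 (vs i)"
      "card (cross (stars d vs) x) \<le> d" by blast
    then show ?thesis using valid_disjoint_balls[OF d1 val disj, of x d] by blast
  qed
qed

section \<open>From stars to a coloring of all vertices\<close>

lemma valid_extends: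
  assumes val: "valid k vs f" and k: "k \<le> Suc d"
  shows "\<exists>g. g ` V \<subseteq> {..d} \<and> (\<forall>u\<in>V. \<forall>w\<in>V. w \<in> N u \<longrightarrow> g u \<noteq> g w) \<and>
    (\<forall>i<k. g (vs i) = i \<and> g ` N (vs i) = {..d} - {i})"
proof -
  have S: "stars k vs \<subseteq> V" using val N_subset by (auto simp: stars_def star_def valid_def)
  have im: "f ` N (vs i) = {..d} - {i}" if "i < k" for i
    using val that by (simp add: valid_def bij_betw_def)
  have "f ` stars k vs \<subseteq> {..d}"
  proof
    fix c assume "c \<in> f ` stars k vs"
    then obtain i u where iu: "i < k" "u \<in> star (vs i)" "c = f u" by (auto simp: stars_def)
    then show "c \<in> {..d}" using im[OF iu(1)] val k by (auto simp: star_def valid_def)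
  qed
  moreover have "\<forall>u\<in>stars k vs. \<forall>w\<in>stars k vs. w \<in> N u \<longrightarrow> f u \<noteq> f w"
    using val unfolding valid_def by blast
  moreover have SV: "stars k vs \<union> V = V" using S by blast
  ultimately obtain g where g: "\<forall>u\<in>stars k vs. g u = f u" "g ` V \<subseteq> {..d}"
    "\<forall>u\<in>V. \<forall>w\<in>V. w \<in> N u \<longrightarrow> g u \<noteq> g w"
    using extend_coloring[OF finite_V, of "stars k vs" f] by auto
  have "g (vs i) = i \<and> g ` N (vs i) = {..d} - {i}" if i: "i < k" for i
  proof -
    have "star (vs i) \<subseteq> stars k vs" using i by (auto simp: stars_def)
    then have "g (vs i) = f (vs i)" "g ` N (vs i) = f ` N (vs i)"
      using g(1) by (auto simp: star_def intro!: image_cong)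
    then show ?thesis using im[OF i] val i by (simp add: valid_def)
  qed
  then show ?thesis using g by blast
qed

lemma exists_b_coloring:
  assumes d: "d \<ge> 1" and big: "card V \<ge> d * (d ^ 2 + 1 + (d - 1) ^ 2)"
  shows "\<exists>g. g ` V \<subseteq> {..d} \<and> (\<forall>u\<in>V. \<forall>w\<in>V. w \<in> N u \<longrightarrow> g u \<noteq> g w) \<and>
    (\<forall>i\<le>d. \<exists>v\<in>V. g v = i \<and> {..d} - {i} \<subseteq> g ` N v)"
proof (cases "d = 1")
  case False
  then obtain vs f where val: "valid (Suc d) vs f" using exists_valid_full big d by force
  then have "vs i \<in> V" if "i \<le> d" for i using that by (simp add: valid_def)
  then show ?thesis using valid_extends[OF val order_refl] by (metis le_imp_less_Suc order_refl)
next
  \<comment> \<open>For d = 1 a single ball may be the whole graph, so a second center need not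
    exist. One star is then an edge whose two ends are dominant for the two colors.\<close>
  case True
  obtain vs f where val: "valid 1 vs f" using exists_valid[OF d big, of 1] d by auto
  obtain g where g: "g ` V \<subseteq> {..d}" "\<forall>u\<in>V. \<forall>w\<in>V. w \<in> N u \<longrightarrow> g u \<noteq> g w"
    "g (vs 0) = 0" "g ` N (vs 0) = {..d} - {0}"
    using valid_extends[OF val] by auto
  have v: "vs 0 \<in> V" using val by (simp add: valid_def)
  have one: "{..d} - {0} = {1}" "{..d} - {1} = {0}" using True by auto
  then obtain u where u: "u \<in> N (vs 0)" "g u = 1" using g(4) by (metis imageE singletonI)
  then have "u \<in> V" "0 \<in> g ` N u" using N_subset N_sym[OF u(1)] g(3) by force+
  then have "\<exists>v\<in>V. g v = i \<and> {..d} - {i} \<subseteq> g ` N v" if "i \<le> d" for i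
  proof (cases "i = 0")
    case True
    then show ?thesis using v g(3,4) by blast
  next
    case False
    then have "i = 1" using that True by simp
    then show ?thesis using u \<open>u \<in> V\<close> \<open>0 \<in> g ` N u\<close> one by auto
  qed
  then show ?thesis using g(1,2) by blast
qed

end

section \<open>The upper bound and the transfer to digraphs\<close>

lemma (in digraph) card_out_neighbours:
  "card {u. v \<rightarrow>\<^bsub>G\<^esub> u} = out_degree G v"
proof -
  have "{u. v \<rightarrow>\<^bsub>G\<^esub> u} = head G ` out_arcs G v"
    by (force simp: arcs_ends_def arc_to_ends_def)
  moreover have "inj_on (head G) (out_arcs G v)"
    using no_multi_arcs by (auto simp: inj_on_def arc_to_ends_def)
  ultimately show ?thesis by (simp add: out_degree_def card_image)
qed

text \<open>A dominant vertex sees every color other than its own among its d neighbours.\<close>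

lemma (in digraph) card_colors_b_coloring_le:
  assumes reg: "regular_graph G d" and b: "b_coloring G c"
  shows "card (colors G c) \<le> d + 1"
proof (cases "colors G c = {}")
  case False
  then obtain i where "i \<in> colors G c" by blast
  then obtain v where v: "v \<in> verts G" "dominant G c v"
    using b by (auto simp: b_coloring_def color_class_def)
  let ?N = "{u. v \<rightarrow>\<^bsub>G\<^esub> u}"
  have N: "finite ?N"
    by (rule finite_subset[of _ "verts G"]) auto
  have "colors G c \<subseteq> insert (c v) (c ` ?N)"
    using v(2) by (auto simp: dominant_def color_class_def)
  then have "card (colors G c) \<le> card (insert (c v) (c ` ?N))"
    using N by (intro card_mono) auto
  also have "\<dots> \<le> Suc (card ?N)"
    using N card_image_le[OF N, of c] by (simp add: card_insert_if)
  finally show ?thesis using reg v(1) by (simp add: card_out_neighbours regular_graph_def)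
qed simp

theorem theorem2p2:
  fixes G :: "('a, 'b) pre_digraph" and d :: nat
  assumes "d \<ge> 1"
    and "graph G"
    and "regular_graph G d"
    and "int (card (verts G)) \<ge> 2 * int d ^ 3 + 2 * int d - 2 * int d ^ 2"
  shows "b_chromatic_number G = d + 1"
proof -
  interpret graph G by fact
  let ?N = "\<lambda>v. {u. v \<rightarrow>\<^bsub>G\<^esub> u}"
  interpret R: regular_nbhd "verts G" ?N d
  proof
    show "card (?N v) = d" if "v \<in> verts G" for v
      using that assms(3) by (simp add: card_out_neighbours regular_graph_def)
    show "v \<in> ?N u" if "u \<in> ?N v" for u v
      using that sym_arcs by (auto dest: arcs_ends_symmetric)
    show "v \<notin> ?N v" for v
      using adj_not_same by blast
  qed auto
  \<comment> \<open>The bound factors as d times the sum of the ball size d^2 + 1 and (d - 1)^2.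
    Splitting on \<open>d\<close> resolves the natural subtraction \<open>d - 1\<close>.\<close>
  have "int (d * (d ^ 2 + 1 + (d - 1) ^ 2)) = 2 * int d ^ 3 + 2 * int d - 2 * int d ^ 2"
    using assms(1)
    by (cases d) (simp_all add: algebra_simps power2_eq_square power3_eq_cube)
  then have "d * (d ^ 2 + 1 + (d - 1) ^ 2) \<le> card (verts G)"
    using assms(4) by linarith
  then obtain g where g: "g ` verts G \<subseteq> {..d}"
    "\<And>u w. u \<in> verts G \<Longrightarrow> w \<in> verts G \<Longrightarrow> w \<in> ?N u \<Longrightarrow> g u \<noteq> g w"
    "\<And>i. i \<le> d \<Longrightarrow> \<exists>v\<in>verts G. g v = i \<and> {..d} - {i} \<subseteq> g ` ?N v"
    using R.exists_b_coloring[OF assms(1)] by blast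
  have colors: "colors G g = {..d}"
    using g(1,3) by (force simp: colors_def)
  have "b_coloring G g"
    unfolding b_coloring_def
  proof (intro conjI ballI)
    show "proper_coloring G g" using g(2) by (auto simp: proper_coloring_def)
    fix i assume "i \<in> colors G g"
    then obtain v where v: "v \<in> verts G" "g v = i" "{..d} - {i} \<subseteq> g ` ?N v"
      using g(3)[of i] colors by auto
    have "dominant G g v"
      unfolding dominant_def
    proof (intro ballI impI)
      fix j assume "j \<in> colors G g" "j \<noteq> g v"
      then have "j \<in> g ` ?N v" using v(2,3) colors by blast
      then obtain u where "v \<rightarrow>\<^bsub>G\<^esub> u" "g u = j" by auto
      then show "\<exists>u\<in>color_class G g j. v \<rightarrow>\<^bsub>G\<^esub> u"
        using adj_in_verts(2) by (auto simp: color_class_def)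
    qed
    then show "\<exists>v\<in>color_class G g i. dominant G g v"
      using v by (auto simp: color_class_def)
  qed
  then have mem: "d + 1 \<in> {k. \<exists>c. b_coloring G c \<and> card (colors G c) = k}"
    using colors by auto
  have le: "k \<le> d + 1" if "k \<in> {k. \<exists>c. b_coloring G c \<and> card (colors G c) = k}" for k
    using that card_colors_b_coloring_le[OF assms(3)] by auto
  then have "finite {k. \<exists>c. b_coloring G c \<and> card (colors G c) = k}"
    by (meson finite_nat_set_iff_bounded_le)
  then show ?thesis
    unfolding b_chromatic_number_def using le mem by (rule Max_eqI)
qed

end
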